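(* For all constants $c > 0$ and $T > 0$ there exists $\alpha > 0$ such that the following holds for every $n$. Let $A$ be an $n \times n$ matrix with non-negative real entries that is a $(q,k,t)$-design matrix with $k \geq c\sqrt{n}$ and $t \leq T$. Then $A$ is $(\alpha n, \alpha\sqrt{n})$-monotonically rigid. For example, one can take $A$ to be the incidence matrix of a finite projective plane.
   Context: For a vector $v$, $\operatorname{supp}(v) = \{i : v_i \neq 0\}$. An $m\times n$ matrix $A$ with rows $R_1,\dots,R_m$ and columns $C_1,\dots,C_n$ is a $(q,k,t)$-design matrix if: (1) $|\operatorname{supp}(R_i)| \le q$ for all $i \in [m]$; (2) $|\operatorname{supp}(C_j)| \ge k$ for all $j \in [n]$; (3) $|\operatorname{supp}(C_{j_1}) \cap \operatorname{supp}(C_{j_2})| \le t$ for all $j_1 \ne j_2 \in [n]$. An $n\times n$ matrix $A$ over a field is $(r,s)$-monotonically rigid if $A$ cannot be written as $A = L + S$ (with $L,S$ matrices over that field) where: (1) $L$ has rank at most $r$; (2) $S$ has at most $s$ nonzero entries per column; and (3) the support of $S$ is contained in that of $A$ (that is, $S_{ij} \neq 0$ implies $A_{ij} \neq 0$). Here the field is $\mathbb{R}$. The incidence matrix of a projective plane of order $p$ is the $n\times n$ $0$-$1$ point-line incidence matrix with $n = p^2+p+1$. *)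

theory Defs
  imports Complex_Main "Jordan_Normal_Form.DL_Rank"
begin

definition supp :: "'a::zero vec \<Rightarrow> nat set" where
  "supp v = {i. i < dim_vec v \<and> v $ i \<noteq> 0}"

definition design_matrix :: "nat \<Rightarrow> nat \<Rightarrow> nat \<Rightarrow> 'a::zero mat \<Rightarrow> bool" where
  "design_matrix q k t A \<longleftrightarrow>
     (\<forall>i<dim_row A. card (supp (row A i)) \<le> q) \<and>
     (\<forall>j<dim_col A. k \<le> card (supp (col A j))) \<and>
     (\<forall>j1<dim_col A. \<forall>j2<dim_col A. j1 \<noteq> j2 \<longrightarrow>
        card (supp (col A j1) \<inter> supp (col A j2)) \<le> t)"

text \<open>The thresholds are real numbers, so that no rounding convention is needed for
  values such as \<open>\<alpha> * n\<close> and \<open>\<alpha> * sqrt n\<close>. The notion is meant for square matrices.\<close>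

definition monotonically_rigid :: "real \<Rightarrow> real \<Rightarrow> 'a::field mat \<Rightarrow> bool" where
  "monotonically_rigid r s A \<longleftrightarrow>
     \<not> (\<exists>L S. L \<in> carrier_mat (dim_row A) (dim_col A) \<and>
              S \<in> carrier_mat (dim_row A) (dim_col A) \<and>
              A = L + S \<and>
              real (vec_space.rank (dim_row A) L) \<le> r \<and>
              (\<forall>j<dim_col A. real (card (supp (col S j))) \<le> s) \<and>
              (\<forall>i<dim_row A. \<forall>j<dim_col A. S $$ (i, j) \<noteq> 0 \<longrightarrow> A $$ (i, j) \<noteq> 0))"

text \<open>Points \<open>P\<close>, lines \<open>Ls\<close>, incidence relation \<open>I\<close>. The last clause is the usual
  non-degeneracy axiom: there are four points, no three of them on a common line.\<close>

definition projective_plane :: "'p set \<Rightarrow> 'l set \<Rightarrow> ('p \<Rightarrow> 'l \<Rightarrow> bool) \<Rightarrow> bool" where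
  "projective_plane P Ls I \<longleftrightarrow>
     (\<forall>x\<in>P. \<forall>y\<in>P. x \<noteq> y \<longrightarrow> (\<exists>!l. l \<in> Ls \<and> I x l \<and> I y l)) \<and>
     (\<forall>l\<in>Ls. \<forall>m\<in>Ls. l \<noteq> m \<longrightarrow> (\<exists>!x. x \<in> P \<and> I x l \<and> I x m)) \<and>
     (\<exists>Q\<subseteq>P. card Q = 4 \<and> (\<forall>l\<in>Ls. card {x \<in> Q. I x l} \<le> 2))"

definition projective_plane_of_order ::
    "nat \<Rightarrow> 'p set \<Rightarrow> 'l set \<Rightarrow> ('p \<Rightarrow> 'l \<Rightarrow> bool) \<Rightarrow> bool" where
  "projective_plane_of_order p P Ls I \<longleftrightarrow>
     projective_plane P Ls I \<and> finite P \<and> finite Ls \<and>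
     (\<forall>l\<in>Ls. card {x \<in> P. I x l} = p + 1)"

text \<open>Rows are indexed by points and columns by lines, in the order given by an
  enumeration (without repetition) of the points and of the lines.\<close>

definition incidence_matrix ::
    "'p list \<Rightarrow> 'l list \<Rightarrow> ('p \<Rightarrow> 'l \<Rightarrow> bool) \<Rightarrow> 'a::{zero,one} mat" where
  "incidence_matrix ps ls I =
     mat (length ps) (length ls) (\<lambda>(i, j). if I (ps ! i) (ls ! j) then 1 else 0)"

text \<open>\<open>plane_incidence_matrix p A\<close>: \<open>A\<close> is the incidence matrix of some projective plane
  of order \<open>p\<close>. Points and lines are natural numbers; since the planes are finite, every
  plane is isomorphic to one of these, whatever the types of its points and lines.\<close>

definition plane_incidence_matrix :: "nat \<Rightarrow> 'a::{zero,one} mat \<Rightarrow> bool" where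
  "plane_incidence_matrix p A \<longleftrightarrow>
     (\<exists>(ps :: nat list) (ls :: nat list) I.
        distinct ps \<and> distinct ls \<and>
        projective_plane_of_order p (set ps) (set ls) I \<and>
        A = incidence_matrix ps ls I)"

end

theory Submission
  imports Defs "HOL-Analysis.Convex"
begin

text \<open>If \<open>A = L + S\<close> with \<open>S\<close> sparse and supported inside \<open>A\<close>, then \<open>L\<close> is again a design
  matrix, with column supports of size at least \<open>c / 2 * sqrt n\<close>; so it suffices that such a
  matrix has rank at least a constant times \<open>n\<close>. Rescaling rows and columns does not raise the rank.
  Scale so that the columns \<open>v\<^sub>j\<close> become unit vectors while the squared norm of each row is
  bounded. Since supports of distinct columns meet in at most \<open>T\<close> places, Cauchy--Schwarz bounds
  the sum of \<open>\<langle>v\<^sub>j, v\<^sub>k\<rangle>\<^sup>2\<close> over all pairs by \<open>O(n)\<close>, and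
  \<open>rank \<ge> (tr M)\<^sup>2 / (Frobenius norm of M)\<^sup>2\<close> for the Gram matrix \<open>M\<close>.

  The scaling exists as soon as the support carries a fractional matching with column sums 1 and
  bounded row sums. After discarding the few rows that meet more than \<open>O(sqrt n)\<close> columns, and
  the columns that lose half of their support, the uniform distribution on each column support is
  such a matching.\<close>

section \<open>Rank, trace and Frobenius norm of a Gram matrix\<close>

text \<open>Induction on the number of spanning vectors: split off the component of every \<open>v j\<close> along
  one of them, which only adds a positive cross term to the Frobenius norm.\<close>

lemma gram_frobenius_bound:
  fixes v :: "'j \<Rightarrow> 'i \<Rightarrow> real"
  assumes "finite U" "finite I" "finite J"
    and "\<And>j i. j \<in> J \<Longrightarrow> i \<in> I \<Longrightarrow> v j i = (\<Sum>a\<in>U. P a i * Q a j)"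
  shows "(\<Sum>j\<in>J. \<Sum>i\<in>I. (v j i)\<^sup>2)\<^sup>2
           \<le> real (card U) * (\<Sum>j\<in>J. \<Sum>k\<in>J. (\<Sum>i\<in>I. v j i * v k i)\<^sup>2)"
  using assms(1,4)
proof (induction U arbitrary: v P rule: finite_induct)
  case empty
  then show ?case by simp
next
  case (insert a U)
  define nrm where "nrm = (\<Sum>i\<in>I. (P a i)\<^sup>2)"
  have nrm0: "nrm \<ge> 0" unfolding nrm_def by (simp add: sum_nonneg)
  show ?case
  proof (cases "nrm = 0")
    case True
    then have "P a i = 0" if "i \<in> I" for i
      using that \<open>finite I\<close> unfolding nrm_def by (subst (asm) sum_nonneg_eq_0_iff) auto
    then have "v j i = (\<Sum>a\<in>U. P a i * Q a j)" if "j \<in> J" "i \<in> I" for j i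
      using insert.prems[OF that] insert.hyps that by simp
    then have "(\<Sum>j\<in>J. \<Sum>i\<in>I. (v j i)\<^sup>2)\<^sup>2
           \<le> real (card U) * (\<Sum>j\<in>J. \<Sum>k\<in>J. (\<Sum>i\<in>I. v j i * v k i)\<^sup>2)"
      by (rule insert.IH)
    also have "\<dots> \<le> real (card (insert a U)) * (\<Sum>j\<in>J. \<Sum>k\<in>J. (\<Sum>i\<in>I. v j i * v k i)\<^sup>2)"
      using insert.hyps by (intro mult_right_mono sum_nonneg) auto
    finally show ?thesis .
  next
    case False
    then have pos: "nrm > 0" using nrm0 by simp
    define u where "u i = P a i / sqrt nrm" for i
    define b where "b j = (\<Sum>i\<in>I. v j i * u i)" for j
    define v' where "v' j i = v j i - b j * u i" for j i
    define c where "c x = (\<Sum>k\<in>I. P x k * u k)" for x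
    \<comment> \<open>Every spanning vector is projected onto the complement of \<open>u\<close>. As
      \<open>P a\<close> is parallel to \<open>u\<close>, its projection vanishes, so
      \<open>v'\<close> factors through \<open>U\<close> alone with the same coefficients
      \<open>Q\<close> and the induction hypothesis applies.\<close>
    define P' where "P' x i = P x i - c x * u i" for x i
    define g where "g j k = (\<Sum>i\<in>I. v' j i * v' k i)" for j k
    have uu: "(\<Sum>i\<in>I. u i * u i) = 1"
    proof -
      have "(\<Sum>i\<in>I. u i * u i) = (\<Sum>i\<in>I. (P a i)\<^sup>2 / nrm)"
        unfolding u_def using pos by (simp add: power2_eq_square)
      also have "\<dots> = 1" using pos by (simp add: nrm_def flip: sum_divide_distrib)
      finally show ?thesis .
    qed
    have Pa: "P' a i = 0" for i
    proof -
      have "P a k = sqrt nrm * u k" for k using pos by (simp add: u_def)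
      then have "c a = sqrt nrm"
        using uu by (simp add: c_def mult.assoc flip: sum_distrib_left)
      then show ?thesis using pos by (simp add: P'_def u_def)
    qed
    have v'_factor: "v' j i = (\<Sum>x\<in>U. P' x i * Q x j)" if "j \<in> J" "i \<in> I" for j i
    proof -
      have "b j = (\<Sum>k\<in>I. (\<Sum>x\<in>insert a U. P x k * Q x j) * u k)"
        unfolding b_def using insert.prems that by (intro sum.cong) auto
      also have "\<dots> = (\<Sum>k\<in>I. \<Sum>x\<in>insert a U. P x k * Q x j * u k)"
        by (simp add: sum_distrib_right)
      also have "\<dots> = (\<Sum>x\<in>insert a U. \<Sum>k\<in>I. P x k * Q x j * u k)"
        by (rule sum.swap)
      also have "\<dots> = (\<Sum>x\<in>insert a U. c x * Q x j)"
        unfolding c_def sum_distrib_right by (intro sum.cong refl) (simp add: mult_ac)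
      finally have b: "b j = (\<Sum>x\<in>insert a U. c x * Q x j)" .
      have "v' j i = (\<Sum>x\<in>insert a U. P' x i * Q x j)"
        unfolding v'_def b insert.prems[OF that] P'_def
        unfolding sum_distrib_right sum_subtractf[symmetric]
        by (intro sum.cong refl) (simp add: algebra_simps)
      then show ?thesis using insert.hyps Pa by simp
    qed
    have v'u: "(\<Sum>i\<in>I. v' j i * u i) = 0" for j
      using uu unfolding v'_def
      by (simp add: left_diff_distrib sum_subtractf mult.assoc b_def flip: sum_distrib_left)
    have inner: "(\<Sum>i\<in>I. v j i * v k i) = b j * b k + g j k" for j k
    proof -
      have "(\<Sum>i\<in>I. v j i * v k i) = (\<Sum>i\<in>I. v' j i * v' k i + b k * (v' j i * u i)
              + b j * (v' k i * u i) + b j * b k * (u i * u i))"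
        by (intro sum.cong) (auto simp: v'_def algebra_simps)
      also have "\<dots> = g j k + b k * 0 + b j * 0 + b j * b k * 1"
        unfolding sum.distrib sum_distrib_left[symmetric] v'u uu g_def by simp
      finally show ?thesis by simp
    qed
    define B where "B = (\<Sum>j\<in>J. (b j)\<^sup>2)"
    define V where "V = (\<Sum>j\<in>J. \<Sum>i\<in>I. (v' j i)\<^sup>2)"
    define G where "G = (\<Sum>j\<in>J. \<Sum>k\<in>J. (g j k)\<^sup>2)"
    have trace: "(\<Sum>j\<in>J. \<Sum>i\<in>I. (v j i)\<^sup>2) = B + V"
      unfolding B_def V_def sum.distrib[symmetric]
      by (intro sum.cong refl) (use inner in \<open>simp add: g_def power2_eq_square\<close>)
    \<comment> \<open>Expanding \<open>g\<close> and summing over \<open>i\<close> last turns the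
      cross term into a sum of squares.\<close>
    have cross: "(\<Sum>j\<in>J. \<Sum>k\<in>J. b j * b k * g j k) \<ge> 0"
    proof -
      have "(\<Sum>j\<in>J. \<Sum>k\<in>J. b j * b k * g j k)
          = (\<Sum>j\<in>J. \<Sum>k\<in>J. \<Sum>i\<in>I. (b j * v' j i) * (b k * v' k i))"
        unfolding g_def by (simp add: sum_distrib_left mult_ac)
      also have "\<dots> = (\<Sum>j\<in>J. \<Sum>i\<in>I. \<Sum>k\<in>J. (b j * v' j i) * (b k * v' k i))"
        by (intro sum.cong refl) (rule sum.swap)
      also have "\<dots> = (\<Sum>i\<in>I. \<Sum>j\<in>J. \<Sum>k\<in>J. (b j * v' j i) * (b k * v' k i))"
        by (rule sum.swap)
      also have "\<dots> = (\<Sum>i\<in>I. (\<Sum>j\<in>J. b j * v' j i)\<^sup>2)"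
        by (simp add: power2_eq_square sum_product)
      finally show ?thesis by (simp add: sum_nonneg)
    qed
    have "(\<Sum>j\<in>J. \<Sum>k\<in>J. (\<Sum>i\<in>I. v j i * v k i)\<^sup>2)
        = (\<Sum>j\<in>J. \<Sum>k\<in>J. (b j)\<^sup>2 * (b k)\<^sup>2 + 2 * (b j * b k * g j k) + (g j k)\<^sup>2)"
      unfolding inner by (intro sum.cong refl) (simp add: power2_eq_square algebra_simps)
    also have "\<dots> = B\<^sup>2 + 2 * (\<Sum>j\<in>J. \<Sum>k\<in>J. b j * b k * g j k) + G"
      by (simp add: sum.distrib B_def G_def power2_eq_square sum_product flip: sum_distrib_left)
    finally have total: "B\<^sup>2 + G \<le> (\<Sum>j\<in>J. \<Sum>k\<in>J. (\<Sum>i\<in>I. v j i * v k i)\<^sup>2)"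
      using cross by simp
    define r where "r = real (card U)"
    have IH: "V\<^sup>2 \<le> r * G"
      using insert.IH[OF v'_factor] unfolding V_def G_def g_def r_def by simp
    have r0: "r \<ge> 0" and G0: "G \<ge> 0" unfolding r_def G_def by (auto intro!: sum_nonneg)
    \<comment> \<open>Here \<open>V\<^sup>2 \<le> r * G\<close> supplies the term
      \<open>V\<^sup>2\<close>, while \<open>2 * B * V \<le> r * B\<^sup>2 + G\<close> comes from
      expanding \<open>(r * B - V)\<^sup>2 \<ge> 0\<close> and dividing by \<open>r\<close>; hence
      the separate case \<open>r = 0\<close>.\<close>
    have "(B + V)\<^sup>2 \<le> (r + 1) * (B\<^sup>2 + G)"
    proof (cases "r = 0")
      case True
      then have "V = 0" using IH by simp
      then show ?thesis using True G0 by simp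
    next
      case False
      then have "r > 0" using r0 by simp
      have "0 \<le> (r * B - V)\<^sup>2" by simp
      also have "\<dots> \<le> r * (r * B\<^sup>2 + G - 2 * B * V)"
        using IH by (simp add: power2_eq_square algebra_simps)
      finally have "0 \<le> r * B\<^sup>2 + G - 2 * B * V"
        using \<open>r > 0\<close> by (simp add: zero_le_mult_iff)
      then show ?thesis using IH by (simp add: power2_eq_square algebra_simps)
    qed
    also have "\<dots> \<le> real (card (insert a U)) * (\<Sum>j\<in>J. \<Sum>k\<in>J. (\<Sum>i\<in>I. v j i * v k i)\<^sup>2)"
      using total r0 insert.hyps by (intro mult_mono) (auto simp: r_def G0)
    finally show ?thesis unfolding trace .
  qed
qed

section \<open>Scaling with bounded row sums\<close>

text \<open>\<open>\<rho>\<close> is an approximate minimizer of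
  \<open>F \<rho> = (\<Sum>j. ln (\<Sum>k. \<rho> k * X k j)) - C * (\<Sum>i. ln (\<rho> i))\<close> over \<open>0 < \<rho> \<le> 1\<close>. The matching
  \<open>w\<close> bounds \<open>F\<close> from below, and if row \<open>i\<close> had sum above \<open>2 * C\<close>, halving \<open>\<rho> i\<close> would lower
  \<open>F\<close> by at least \<open>C * (1 - ln 2)\<close>.\<close>

lemma row_scaling_exists:
  fixes X w :: "'i \<Rightarrow> 'j \<Rightarrow> real"
  assumes fin: "finite I" "finite J"
    and X: "\<And>i j. X i j \<ge> 0"
    and w: "\<And>i j. w i j \<ge> 0" "\<And>i j. w i j \<noteq> 0 \<Longrightarrow> X i j > 0"
    and cols: "\<And>j. j \<in> J \<Longrightarrow> (\<Sum>i\<in>I. w i j) = 1"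
    and rows: "\<And>i. i \<in> I \<Longrightarrow> (\<Sum>j\<in>J. w i j) \<le> C"
    and C: "C > 0"
  obtains \<rho> where "\<And>i. \<rho> i > 0" "\<And>j. j \<in> J \<Longrightarrow> (\<Sum>k\<in>I. \<rho> k * X k j) > 0"
    "\<And>i. i \<in> I \<Longrightarrow> (\<Sum>j\<in>J. \<rho> i * X i j / (\<Sum>k\<in>I. \<rho> k * X k j)) \<le> 2 * C"
proof -
  \<comment> \<open>The cap at 1 makes every \<open>ln (\<rho> i)\<close> nonpositive, so that the
    row bound \<open>C\<close> on \<open>w\<close> gives a lower bound for \<open>F\<close>.\<close>
  define A where "A = {\<rho> :: 'i \<Rightarrow> real. \<forall>i. 0 < \<rho> i \<and> \<rho> i \<le> 1}"
  define s where "s \<rho> j = (\<Sum>k\<in>I. \<rho> k * X k j)" for \<rho> j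
  define F where "F \<rho> = (\<Sum>j\<in>J. ln (s \<rho> j)) - C * (\<Sum>i\<in>I. ln (\<rho> i))" for \<rho>
  define K where "K = (\<Sum>j\<in>J. \<Sum>i\<in>I. w i j * ln (X i j))"
  have s_ge: "\<rho> i * X i j \<le> s \<rho> j" if "\<rho> \<in> A" "i \<in> I" for \<rho> i j
  proof -
    have "\<And>k. 0 \<le> \<rho> k * X k j" using that(1) X by (simp add: A_def less_imp_le)
    then show ?thesis unfolding s_def using that(2) fin(1) by (intro member_le_sum) auto
  qed
  have s_pos: "s \<rho> j > 0" if \<rho>: "\<rho> \<in> A" and j: "j \<in> J" for \<rho> j
  proof -
    obtain i where i: "i \<in> I" "w i j \<noteq> 0"
      using cols[OF j] by (metis sum.neutral zero_neq_one)
    have "0 < \<rho> i * X i j" using \<rho> w(2)[OF i(2)] by (simp add: A_def)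
    also have "\<dots> \<le> s \<rho> j" using s_ge \<rho> i(1) by blast
    finally show ?thesis .
  qed
  have lower: "K \<le> F \<rho>" if \<rho>: "\<rho> \<in> A" for \<rho>
  proof -
    \<comment> \<open>Each summand of \<open>s \<rho> j\<close> is at most the whole sum, and the
      weights \<open>w i j\<close> of a column add up to 1. Where \<open>X i j\<close> may be 0, the
      default value of \<open>ln\<close> is multiplied by \<open>w i j = 0\<close>.\<close>
    have "(\<Sum>i\<in>I. w i j * (ln (\<rho> i) + ln (X i j))) \<le> ln (s \<rho> j)" if j: "j \<in> J" for j
    proof -
      have "w i j * (ln (\<rho> i) + ln (X i j)) \<le> w i j * ln (s \<rho> j)" if "i \<in> I" for i
      proof (cases "w i j = 0")
        case False
        have "0 < \<rho> i" using \<rho> by (simp add: A_def)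
        then have "ln (\<rho> i) + ln (X i j) = ln (\<rho> i * X i j)"
          using w(2)[OF False] by (simp add: ln_mult)
        also have "\<dots> \<le> ln (s \<rho> j)"
          using s_ge[OF \<rho> that] w(2)[OF False] \<open>0 < \<rho> i\<close> by (intro ln_mono) auto
        finally show ?thesis using w(1) by (simp add: mult_left_mono)
      qed simp
      then have "(\<Sum>i\<in>I. w i j * (ln (\<rho> i) + ln (X i j))) \<le> (\<Sum>i\<in>I. w i j * ln (s \<rho> j))"
        by (rule sum_mono)
      also have "\<dots> = ln (s \<rho> j)" using cols[OF j] by (simp flip: sum_distrib_right)
      finally show ?thesis .
    qed
    then have "(\<Sum>j\<in>J. \<Sum>i\<in>I. w i j * (ln (\<rho> i) + ln (X i j))) \<le> (\<Sum>j\<in>J. ln (s \<rho> j))"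
      by (rule sum_mono)
    moreover have "(\<Sum>j\<in>J. \<Sum>i\<in>I. w i j * (ln (\<rho> i) + ln (X i j)))
        = (\<Sum>i\<in>I. (\<Sum>j\<in>J. w i j) * ln (\<rho> i)) + K"
      unfolding K_def distrib_left sum.distrib sum_distrib_right
      by (subst sum.swap) simp
    moreover have "C * (\<Sum>i\<in>I. ln (\<rho> i)) \<le> (\<Sum>i\<in>I. (\<Sum>j\<in>J. w i j) * ln (\<rho> i))"
      unfolding sum_distrib_left using \<rho> rows
      by (intro sum_mono mult_right_mono_neg) (auto simp: A_def)
    ultimately show ?thesis unfolding F_def by simp
  qed
  \<comment> \<open>Halving one \<open>\<rho> i\<close> raises the second part of \<open>F\<close>
    by \<open>C * ln 2\<close>, and for a row of sum above \<open>2 * C\<close> it lowers the first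
    part by at least \<open>C\<close>.\<close>
  define \<delta> where "\<delta> = C * (1 - ln 2)"
  have "\<delta> > 0" using C ln_2_less_1 by (simp add: \<delta>_def)
  have A1: "(\<lambda>_. 1) \<in> A" by (simp add: A_def)
  have bdd: "bdd_below (F ` A)" using lower by (rule bdd_belowI2)
  \<comment> \<open>\<open>A\<close> is not closed, so the infimum need not be attained; a point
    within \<open>\<delta>\<close> of it suffices.\<close>
  have "\<exists>y\<in>F ` A. y < Inf (F ` A) + \<delta>"
    using A1 \<open>\<delta> > 0\<close> by (intro cInf_lessD) auto
  then obtain \<rho> where \<rho>: "\<rho> \<in> A" "F \<rho> < Inf (F ` A) + \<delta>" by blast
  have near: "F \<rho> < F \<rho>' + \<delta>" if "\<rho>' \<in> A" for \<rho>'
    using \<rho>(2) cInf_lower[OF imageI[OF that] bdd] by linarith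
  show ?thesis
  proof (rule that)
    show "\<rho> i > 0" for i using \<rho>(1) by (simp add: A_def)
    show "(\<Sum>k\<in>I. \<rho> k * X k j) > 0" if "j \<in> J" for j
      using s_pos[OF \<rho>(1) that] by (simp add: s_def)
    show "(\<Sum>j\<in>J. \<rho> i * X i j / (\<Sum>k\<in>I. \<rho> k * X k j)) \<le> 2 * C" if i: "i \<in> I" for i
    proof (rule ccontr)
      assume "\<not> ?thesis"
      then have big: "(\<Sum>j\<in>J. \<rho> i * X i j / s \<rho> j) > 2 * C" by (simp add: s_def)
      define \<rho>' where "\<rho>' = \<rho>(i := \<rho> i / 2)"
      have \<rho>'A: "\<rho>' \<in> A" 
        unfolding A_def \<rho>'_def
      proof (intro CollectI allI)
        fix k
        have "0 < \<rho> k" "\<rho> k \<le> 1" using \<rho>(1) by (auto simp: A_def)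
        then show "0 < (\<rho>(i := \<rho> i / 2)) k \<and> (\<rho>(i := \<rho> i / 2)) k \<le> 1" by auto
      qed
      have pos: "\<rho> i > 0" using \<rho>(1) by (simp add: A_def)
      have s': "s \<rho>' j = s \<rho> j - \<rho> i * X i j / 2" for j
        unfolding s_def \<rho>'_def using i fin(1) by (simp add: sum.remove)
      \<comment> \<open>This is \<open>ln x \<le> x - 1\<close> at the ratio of the new column sum
        to the old one.\<close>
      have "ln (s \<rho>' j) \<le> ln (s \<rho> j) - (\<rho> i * X i j / s \<rho> j) / 2" if j: "j \<in> J" for j
      proof -
        have p: "s \<rho> j > 0" "s \<rho>' j > 0" using s_pos \<rho>(1) \<rho>'A j by auto
        then have "ln (s \<rho>' j) - ln (s \<rho> j) \<le> s \<rho>' j / s \<rho> j - 1"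
          using ln_le_minus_one[of "s \<rho>' j / s \<rho> j"] by (simp add: ln_div)
        also have "\<dots> = - (\<rho> i * X i j / s \<rho> j) / 2"
          using p by (simp add: s' field_simps)
        finally show ?thesis by simp
      qed
      then have "(\<Sum>j\<in>J. ln (s \<rho>' j)) \<le> (\<Sum>j\<in>J. ln (s \<rho> j) - (\<rho> i * X i j / s \<rho> j) / 2)"
        by (rule sum_mono)
      also have "\<dots> = (\<Sum>j\<in>J. ln (s \<rho> j)) - (\<Sum>j\<in>J. \<rho> i * X i j / s \<rho> j) / 2"
        by (simp add: sum_subtractf sum_divide_distrib)
      finally have 1: "(\<Sum>j\<in>J. ln (s \<rho>' j)) \<le> (\<Sum>j\<in>J. ln (s \<rho> j)) - C" using big by simp
      have 2: "(\<Sum>k\<in>I. ln (\<rho>' k)) = (\<Sum>k\<in>I. ln (\<rho> k)) - ln 2"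
        unfolding \<rho>'_def using i fin(1) pos by (simp add: sum.remove ln_div)
      have "F \<rho>' \<le> F \<rho> - \<delta>"
        using 1 unfolding F_def 2 \<delta>_def by (simp add: algebra_simps)
      then show False using near[OF \<rho>'A] by simp
    qed
  qed
qed

text \<open>After scaling, the columns \<open>v j\<close> are unit vectors and the rows have squared
  norm at most \<open>2 * C\<close>. The Gram matrix then has trace \<open>card J\<close> and
  squared Frobenius norm at most \<open>card J * (1 + 2 * C * T)\<close>, and
  \<open>gram_frobenius_bound\<close> compares the two.\<close>

lemma weighted_design_factor_bound:
  fixes L w :: "'i \<Rightarrow> 'j \<Rightarrow> real"
  assumes fin: "finite I" "finite J" "finite U"
    and factor: "\<And>i j. i \<in> I \<Longrightarrow> j \<in> J \<Longrightarrow> L i j = (\<Sum>a\<in>U. P a i * Q a j)"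
    and w: "\<And>i j. w i j \<ge> 0" "\<And>i j. w i j \<noteq> 0 \<Longrightarrow> L i j \<noteq> 0"
    and cols: "\<And>j. j \<in> J \<Longrightarrow> (\<Sum>i\<in>I. w i j) = 1"
    and rows: "\<And>i. i \<in> I \<Longrightarrow> (\<Sum>j\<in>J. w i j) \<le> C"
    and C: "C > 0" and T: "T \<ge> 0"
    and meet: "\<And>j k. j \<in> J \<Longrightarrow> k \<in> J \<Longrightarrow> j \<noteq> k \<Longrightarrow>
      real (card {i \<in> I. L i j \<noteq> 0 \<and> L i k \<noteq> 0}) \<le> T"
  shows "real (card J) \<le> real (card U) * (1 + 2 * C * T)"
proof -
  obtain \<rho> where \<rho>: "\<And>i. \<rho> i > 0" "\<And>j. j \<in> J \<Longrightarrow> (\<Sum>k\<in>I. \<rho> k * (L k j)\<^sup>2) > 0"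
    "\<And>i. i \<in> I \<Longrightarrow> (\<Sum>j\<in>J. \<rho> i * (L i j)\<^sup>2 / (\<Sum>k\<in>I. \<rho> k * (L k j)\<^sup>2)) \<le> 2 * C"
    using row_scaling_exists[OF fin(1,2), of "\<lambda>i j. (L i j)\<^sup>2" w C] w cols rows C by auto
  define s where "s j = (\<Sum>k\<in>I. \<rho> k * (L k j)\<^sup>2)" for j
  \<comment> \<open>The row scaling was applied to the squares of \<open>L\<close>, hence the square
    roots. One factor depends on the row and one on the column, so \<open>v\<close> still factors
    through \<open>U\<close>.\<close>
  define v where "v j i = sqrt (\<rho> i) / sqrt (s j) * L i j" for j i
  have s: "s j > 0" if "j \<in> J" for j using \<rho>(2) that by (simp add: s_def)
  have v2: "(v j i)\<^sup>2 = \<rho> i * (L i j)\<^sup>2 / s j" if "j \<in> J" for j i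
    using s[OF that] \<rho>(1)[of i] by (simp add: v_def power_mult_distrib power_divide)
  have col: "(\<Sum>i\<in>I. (v j i)\<^sup>2) = 1" if "j \<in> J" for j
  proof -
    have "(\<Sum>i\<in>I. (v j i)\<^sup>2) = s j / s j"
      using that by (simp add: v2 s_def flip: sum_divide_distrib)
    then show ?thesis using s[OF that] by simp
  qed
  have row: "(\<Sum>j\<in>J. (v j i)\<^sup>2) \<le> 2 * C" if "i \<in> I" for i
    using \<rho>(3)[OF that] by (simp add: v2 s_def)
  have vfac: "v j i = (\<Sum>a\<in>U. (sqrt (\<rho> i) * P a i) * (Q a j / sqrt (s j)))"
    if "j \<in> J" "i \<in> I" for j i
    unfolding v_def factor[OF that(2,1)] by (simp add: sum_distrib_left mult_ac)
  \<comment> \<open>Cauchy-Schwarz on the common support \<open>M\<close>, which has at most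
    \<open>T\<close> elements.\<close>
  have offdiag: "(\<Sum>i\<in>I. v j i * v k i)\<^sup>2 \<le> T * (\<Sum>i\<in>I. (v j i)\<^sup>2 * (v k i)\<^sup>2)"
    if "j \<in> J" "k \<in> J" "j \<noteq> k" for j k
  proof -
    define M where "M = {i \<in> I. L i j \<noteq> 0 \<and> L i k \<noteq> 0}"
    have "(\<Sum>i\<in>I. v j i * v k i) = (\<Sum>i\<in>M. v j i * v k i)"
      unfolding M_def using fin(1) by (intro sum.mono_neutral_right) (auto simp: v_def)
    then have "(\<Sum>i\<in>I. v j i * v k i)\<^sup>2 \<le> (\<Sum>i\<in>M. (v j i * v k i)\<^sup>2) * card M"
      using sum_squared_le_sum_of_squares[of "\<lambda>i. v j i * v k i" M] by simp
    also have "\<dots> \<le> (\<Sum>i\<in>I. (v j i * v k i)\<^sup>2) * T"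
      using meet[OF that] fin(1) unfolding M_def
      by (intro mult_mono sum_mono2 sum_nonneg) auto
    finally show ?thesis by (simp add: power_mult_distrib mult.commute)
  qed
  have "(\<Sum>j\<in>J. \<Sum>k\<in>J. (\<Sum>i\<in>I. v j i * v k i)\<^sup>2)
      \<le> (\<Sum>j\<in>J. \<Sum>k\<in>J. (if j = k then 1 else 0) + T * (\<Sum>i\<in>I. (v j i)\<^sup>2 * (v k i)\<^sup>2))"
  proof (intro sum_mono)
    fix j k assume jk: "j \<in> J" "k \<in> J"
    show "(\<Sum>i\<in>I. v j i * v k i)\<^sup>2
      \<le> (if j = k then 1 else 0) + T * (\<Sum>i\<in>I. (v j i)\<^sup>2 * (v k i)\<^sup>2)"
    proof (cases "j = k")
      case True
      have "0 \<le> T * (\<Sum>i\<in>I. (v j i)\<^sup>2 * (v k i)\<^sup>2)"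
        using T by (intro mult_nonneg_nonneg sum_nonneg) auto
      then show ?thesis using True col[OF jk(1)] by (simp add: power2_eq_square)
    qed (use offdiag[OF jk] in simp)
  qed
  also have "\<dots> = real (card J) + T * (\<Sum>j\<in>J. \<Sum>k\<in>J. \<Sum>i\<in>I. (v j i)\<^sup>2 * (v k i)\<^sup>2)"
    using fin by (simp add: sum.distrib flip: sum_distrib_left)
  \<comment> \<open>Summing over \<open>k\<close> first leaves squared row norms, bounded by
    \<open>2 * C\<close>; the remaining sum over \<open>i\<close> is then a squared column norm,
    which is 1.\<close>
  also have "(\<Sum>j\<in>J. \<Sum>k\<in>J. \<Sum>i\<in>I. (v j i)\<^sup>2 * (v k i)\<^sup>2)
      = (\<Sum>j\<in>J. \<Sum>i\<in>I. (v j i)\<^sup>2 * (\<Sum>k\<in>J. (v k i)\<^sup>2))"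
    unfolding sum_distrib_left by (intro sum.cong refl) (rule sum.swap)
  also have "T * \<dots> \<le> T * (\<Sum>j\<in>J. \<Sum>i\<in>I. (v j i)\<^sup>2 * (2 * C))"
    using row T by (intro mult_left_mono sum_mono) auto
  also have "(\<Sum>j\<in>J. \<Sum>i\<in>I. (v j i)\<^sup>2 * (2 * C)) = real (card J) * (2 * C)"
    using col by (simp flip: sum_distrib_right)
  finally have S: "(\<Sum>j\<in>J. \<Sum>k\<in>J. (\<Sum>i\<in>I. v j i * v k i)\<^sup>2)
      \<le> real (card J) * (1 + 2 * C * T)" by (simp add: algebra_simps)
  have "(real (card J))\<^sup>2 = (\<Sum>j\<in>J. \<Sum>i\<in>I. (v j i)\<^sup>2)\<^sup>2" using col by simp
  also have "\<dots> \<le> real (card U) * (\<Sum>j\<in>J. \<Sum>k\<in>J. (\<Sum>i\<in>I. v j i * v k i)\<^sup>2)"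
    using fin(3,1,2) vfac by (rule gram_frobenius_bound)
  also have "\<dots> \<le> real (card U) * (real (card J) * (1 + 2 * C * T))"
    using S by (intro mult_left_mono) auto
  finally have "real (card J) * real (card J) \<le> real (card J) * (real (card U) * (1 + 2 * C * T))"
    by (simp add: power2_eq_square mult_ac)
  then show ?thesis using C T by (cases "card J = 0") (auto simp: mult_le_cancel_left)
qed

section \<open>Rank of design matrices\<close>

text \<open>\<open>U\<close> is a maximal independent set of columns, so it spans all of them;
  \<open>Q u j\<close> is the coefficient of \<open>u\<close> in column \<open>j\<close>. This puts
  the rank into the form of the factorization bounds above.\<close>

lemma (in vec_space) rank_factorization:
  assumes A: "A \<in> carrier_mat n nc"
  obtains U Q where "finite U" "card U = rank A"
    "\<And>i j. i < n \<Longrightarrow> j < nc \<Longrightarrow> A $$ (i, j) = (\<Sum>u\<in>U. u $ i * Q u j)"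
proof -
  have carr: "set (cols A) \<subseteq> carrier_vec n" using cols_dim A by blast
  obtain U where U: "maximal U (\<lambda>T. T \<subseteq> set (cols A) \<and> lin_indpt T)"
    using maximal_exists_superset[of "set (cols A)" "\<lambda>T. T \<subseteq> set (cols A) \<and> lin_indpt T" "{}"]
    by (auto simp: finite_lin_indpt2)
  then have sub: "U \<subseteq> set (cols A)" and ind: "lin_indpt U"
    and max: "\<And>B. U \<subseteq> B \<Longrightarrow> B \<subseteq> set (cols A) \<Longrightarrow> lin_indpt B \<Longrightarrow> B = U"
    by (auto simp: maximal_def)
  have fin: "finite U" using sub finite_subset by blast
  have Uc: "U \<subseteq> carrier_vec n" using sub carr by blast
  have "\<exists>a. lincomb a U = col A j" if "j < nc" for j
  proof -
    have j: "col A j \<in> set (cols A)" using that A by (metis carrier_matD(2) cols_length cols_nth nth_mem)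
    have "col A j \<in> span U"
    proof (cases "col A j \<in> U")
      case True
      then show ?thesis using span_mem[OF Uc] by blast
    next
      case False
      then have "lin_dep (insert (col A j) U)" using max[of "insert (col A j) U"] j sub by blast
      then show ?thesis using lin_dep_iff_in_span[OF Uc ind _ False] j carr by auto
    qed
    then show ?thesis using finite_in_span[OF fin Uc] by blast
  qed
  then have "\<forall>j. \<exists>a. j < nc \<longrightarrow> lincomb a U = col A j" by blast
  then obtain q where q: "\<And>j. j < nc \<Longrightarrow> lincomb (q j) U = col A j"
    using choice[of "\<lambda>j a. j < nc \<longrightarrow> lincomb a U = col A j"] by blast
  show ?thesis
  proof (rule that[OF fin])
    show "card U = rank A" using rank_card_indpt[OF A U] by simp
    show "A $$ (i, j) = (\<Sum>u\<in>U. u $ i * q j u)" if "i < n" "j < nc" for i j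
    proof -
      have "A $$ (i, j) = lincomb (q j) U $ i" using q that A by simp
      then show ?thesis using lincomb_index[OF that(1) Uc] by (simp add: mult.commute)
    qed
  qed
qed

text \<open>Double counting of triples \<open>(i, j, k)\<close> with \<open>E i j\<close> and
  \<open>E i k\<close>: each of the \<open>n\<close> pairs with \<open>j = k\<close> contributes at
  most \<open>n\<close>, every other pair at most \<open>T\<close>.\<close>

lemma sum_row_degrees_squared:
  fixes E :: "nat \<Rightarrow> nat \<Rightarrow> bool"
  assumes T: "T \<ge> 0"
    and meet: "\<And>j k. j < n \<Longrightarrow> k < n \<Longrightarrow> j \<noteq> k \<Longrightarrow> real (card {i. i < n \<and> E i j \<and> E i k}) \<le> T"
  shows "(\<Sum>i<n. (real (card {j. j < n \<and> E i j}))\<^sup>2) \<le> (real n)\<^sup>2 * (1 + T)"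
proof -
  have ind: "real (card {x. x < n \<and> R x}) = (\<Sum>x<n. of_bool (R x))" for R
  proof -
    have "{x. x < n \<and> R x} = {..<n} \<inter> {x. R x}" by auto
    then show ?thesis by (simp add: sum_of_bool_eq)
  qed
  have "(\<Sum>i<n. (real (card {j. j < n \<and> E i j}))\<^sup>2)
      = (\<Sum>i<n. \<Sum>j<n. \<Sum>k<n. of_bool (E i j \<and> E i k))"
    unfolding ind power2_eq_square sum_product of_bool_conj ..
  also have "\<dots> = (\<Sum>j<n. \<Sum>i<n. \<Sum>k<n. of_bool (E i j \<and> E i k))" by (rule sum.swap)
  also have "\<dots> = (\<Sum>j<n. \<Sum>k<n. real (card {i. i < n \<and> E i j \<and> E i k}))"
    unfolding ind by (rule sum.cong[OF refl]) (rule sum.swap)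
  also have "\<dots> \<le> (\<Sum>j<n. \<Sum>k<n. (if j = k then real n else 0) + T)"
  proof (intro sum_mono)
    fix j k assume jk: "j \<in> {..<n}" "k \<in> {..<n}"
    have "card {i. i < n \<and> E i j \<and> E i k} \<le> card {..<n}" by (rule card_mono) auto
    then show "real (card {i. i < n \<and> E i j \<and> E i k}) \<le> (if j = k then real n else 0) + T"
      using meet[of j k] jk T by auto
  qed
  also have "\<dots> = (real n)\<^sup>2 * (1 + T)"
    by (simp add: sum.distrib power2_eq_square algebra_simps)
  finally show ?thesis .
qed

text \<open>A column that loses more than half of the guaranteed support has at least
  \<open>\<kappa> / 2 * sqrt n\<close> entries in heavy rows. The second moment of the row degrees
  limits the incidences with heavy rows, hence the number of such columns.\<close>

lemma light_rows_good_columns: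
  fixes E :: "nat \<Rightarrow> nat \<Rightarrow> bool"
  assumes n: "n \<ge> 1" and \<kappa>: "\<kappa> > 0" and T: "T \<ge> 0"
    and size: "\<And>j. j < n \<Longrightarrow> \<kappa> * sqrt n \<le> card {i. i < n \<and> E i j}"
    and meet: "\<And>j k. j < n \<Longrightarrow> k < n \<Longrightarrow> j \<noteq> k \<Longrightarrow> real (card {i. i < n \<and> E i j \<and> E i k}) \<le> T"
  obtains I J where "I \<subseteq> {..<n}" "J \<subseteq> {..<n}" "real n / 2 \<le> card J"
    "\<And>j. j \<in> J \<Longrightarrow> \<kappa> / 2 * sqrt n \<le> card {i \<in> I. E i j}"
    "\<And>i. i \<in> I \<Longrightarrow> card {j. j < n \<and> E i j} \<le> 4 * (1 + T) / \<kappa> * sqrt n"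
proof -
  \<comment> \<open>Chosen so that \<open>\<kappa> / 2 * sqrt n * D\<close> equals
    \<open>2 * n * (1 + T)\<close>, which makes the final count give at most \<open>n / 2\<close>
    bad columns.\<close>
  define D where "D = 4 * (1 + T) / \<kappa> * sqrt n"
  define d where "d i = real (card {j. j < n \<and> E i j})" for i
  define I where "I = {i. i < n \<and> d i \<le> D}"
  define H where "H = {i. i < n \<and> \<not> d i \<le> D}"
  define J where "J = {j. j < n \<and> \<kappa> / 2 * sqrt n \<le> card {i \<in> I. E i j}}"
  define B where "B = {j. j < n \<and> \<not> \<kappa> / 2 * sqrt n \<le> card {i \<in> I. E i j}}"
  have D: "D > 0" unfolding D_def using n \<kappa> T by simp
  have fin: "finite I" "finite H" "finite J" "finite B"
    unfolding I_def H_def J_def B_def by auto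
  have heavy: "\<kappa> / 2 * sqrt n \<le> card {i \<in> H. E i j}" if "j \<in> B" for j
  proof -
    have "{i. i < n \<and> E i j} = {i \<in> I. E i j} \<union> {i \<in> H. E i j}"
      unfolding I_def H_def by auto
    then have "card {i. i < n \<and> E i j} \<le> card {i \<in> I. E i j} + card {i \<in> H. E i j}"
      using card_Un_le by metis
    then show ?thesis using size[of j] that unfolding B_def by simp
  qed
  have "(real (card B) * (\<kappa> / 2 * sqrt n)) * D \<le> (\<Sum>j\<in>B. real (card {i \<in> H. E i j})) * D"
    using heavy D by (intro mult_right_mono sum_bounded_below) auto
  also have "(\<Sum>j\<in>B. real (card {i \<in> H. E i j})) = (\<Sum>j\<in>B. \<Sum>i\<in>H. of_bool (E i j))"
    using fin by (simp add: Int_def)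
  also have "\<dots> = (\<Sum>i\<in>H. \<Sum>j\<in>B. of_bool (E i j))" by (rule sum.swap)
  also have "\<dots> = (\<Sum>i\<in>H. real (card {j \<in> B. E i j}))"
    using fin by (simp add: Int_def)
  also have "\<dots> \<le> (\<Sum>i\<in>H. d i)"
    unfolding d_def B_def by (intro sum_mono) (auto intro!: card_mono)
  \<comment> \<open>Heavy rows have \<open>d i > D\<close>, so a first moment over \<open>H\<close>
    is traded for a second moment.\<close>
  also have "(\<Sum>i\<in>H. d i) * D \<le> (\<Sum>i\<in>H. (d i)\<^sup>2)"
    unfolding sum_distrib_right power2_eq_square
    by (intro sum_mono mult_left_mono) (auto simp: H_def d_def)
  also have "\<dots> \<le> (\<Sum>i<n. (d i)\<^sup>2)" by (intro sum_mono2) (auto simp: H_def)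
  also have "\<dots> \<le> (real n)\<^sup>2 * (1 + T)"
    unfolding d_def using sum_row_degrees_squared[OF T meet] by simp
  finally have bound: "(real (card B) * (\<kappa> / 2 * sqrt n)) * D \<le> (real n)\<^sup>2 * (1 + T)"
    using D by (simp add: mult_right_mono)
  have eq: "(real (card B) * (\<kappa> / 2 * sqrt n)) * D = real (card B) * 2 * (real n * (1 + T))"
  proof -
    have "(b * (\<kappa> / 2 * s)) * (4 * (1 + T) / \<kappa> * s) = b * 2 * ((s * s) * (1 + T))" for b s
      using \<kappa> by (simp add: field_simps)
    then show ?thesis unfolding D_def by simp
  qed
  have "(real (card B) * 2) * (real n * (1 + T)) \<le> real n * (real n * (1 + T))"
    using bound unfolding eq by (simp only: power2_eq_square mult.assoc)
  then have "real (card B) * 2 \<le> real n"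
    using n T by (simp add: mult_le_cancel_right)
  moreover have "card B + card J = n"
  proof -
    have "B \<union> J = {..<n}" "B \<inter> J = {}" unfolding B_def J_def by auto
    then show ?thesis using card_Un_disjoint[of B J] fin by simp
  qed
  ultimately have "real n / 2 \<le> card J" by linarith
  then show ?thesis
    by (intro that[of I J]) (auto simp: I_def J_def d_def D_def)
qed

lemma card_le_rank_of_design:
  fixes L :: "real mat"
  assumes n: "n \<ge> 1" and \<kappa>: "\<kappa> > 0" and T: "T \<ge> 0" and L: "L \<in> carrier_mat n n"
    and size: "\<And>j. j < n \<Longrightarrow> \<kappa> * sqrt n \<le> card (supp (col L j))"
    and meet: "\<And>j k. j < n \<Longrightarrow> k < n \<Longrightarrow> j \<noteq> k \<Longrightarrow>
      real (card (supp (col L j) \<inter> supp (col L k))) \<le> T"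
  shows "real n \<le> real (vec_space.rank n L) * (2 * (1 + 16 * T * (1 + T) / \<kappa>\<^sup>2))"
proof -
  define E where "E i j \<longleftrightarrow> L $$ (i, j) \<noteq> 0" for i j
  \<comment> \<open>The quotient of the degree bound \<open>4 * (1 + T) / \<kappa> * sqrt n\<close>
    for light rows by the least support size \<open>\<kappa> / 2 * sqrt n\<close> of good columns;
    \<open>sqrt n\<close> cancels, so \<open>C\<close> is independent of \<open>n\<close>.\<close>
  define C where "C = 8 * (1 + T) / \<kappa>\<^sup>2"
  have supp: "supp (col L j) = {i. i < n \<and> E i j}" if "j < n" for j
    using that L unfolding supp_def E_def by auto
  have sizeE: "\<kappa> * sqrt n \<le> card {i. i < n \<and> E i j}" if "j < n" for j
    using size[OF that] supp[OF that] by simp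
  have meetE: "real (card {i. i < n \<and> E i j \<and> E i k}) \<le> T"
    if "j < n" "k < n" "j \<noteq> k" for j k
  proof -
    have "{i. i < n \<and> E i j \<and> E i k} = supp (col L j) \<inter> supp (col L k)"
      using supp that by auto
    then show ?thesis using meet[OF that] by simp
  qed
  obtain I J where IJ: "I \<subseteq> {..<n}" "J \<subseteq> {..<n}" "real n / 2 \<le> card J"
    and good: "\<And>j. j \<in> J \<Longrightarrow> \<kappa> / 2 * sqrt n \<le> card {i \<in> I. E i j}"
    and light: "\<And>i. i \<in> I \<Longrightarrow> card {j. j < n \<and> E i j} \<le> 4 * (1 + T) / \<kappa> * sqrt n"
    by (rule light_rows_good_columns[where E = E, OF n \<kappa> T sizeE meetE])
      (assumption | rule that)+
  have fin: "finite I" "finite J" using IJ finite_subset by blast+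
  define w where "w i j = (if i \<in> I \<and> j \<in> J \<and> E i j then 1 / real (card {i \<in> I. E i j}) else 0)"
    for i j
  define \<mu> where "\<mu> = \<kappa> / 2 * sqrt n"
  have \<mu>: "\<mu> > 0" unfolding \<mu>_def using n \<kappa> by simp
  have cols: "(\<Sum>i\<in>I. w i j) = 1" if "j \<in> J" for j
  proof -
    have "card {i \<in> I. E i j} \<noteq> 0" using good[OF that] \<mu> unfolding \<mu>_def by (metis not_less of_nat_0)
    moreover have "(\<Sum>i\<in>I. w i j) = (\<Sum>i\<in>{i \<in> I. E i j}. 1 / real (card {i \<in> I. E i j}))"
      unfolding w_def using that fin by (subst sum.inter_filter) (auto intro!: sum.cong)
    ultimately show ?thesis by simp
  qed
  have rows: "(\<Sum>j\<in>J. w i j) \<le> C" if i: "i \<in> I" for i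
  proof -
    have "(\<Sum>j\<in>J. w i j) \<le> (\<Sum>j\<in>J. if E i j then 1 / \<mu> else 0)"
    proof (rule sum_mono)
      fix j assume "j \<in> J"
      then have "\<mu> \<le> card {i \<in> I. E i j}" using good by (simp add: \<mu>_def)
      then show "w i j \<le> (if E i j then 1 / \<mu> else 0)"
        using \<mu> by (simp add: w_def frac_le)
    qed
    also have "\<dots> = real (card {j \<in> J. E i j}) / \<mu>"
      using fin by (simp flip: sum.inter_filter)
    also have "\<dots> \<le> (4 * (1 + T) / \<kappa> * sqrt n) / \<mu>"
    proof (rule divide_right_mono)
      have "card {j \<in> J. E i j} \<le> card {j. j < n \<and> E i j}"
        using IJ by (intro card_mono) auto
      then show "real (card {j \<in> J. E i j}) \<le> 4 * (1 + T) / \<kappa> * sqrt n"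
        using light[OF i] by simp
    qed (use \<mu> in simp)
    also have "\<dots> = C" unfolding \<mu>_def C_def using n \<kappa> by (simp add: field_simps power2_eq_square)
    finally show ?thesis .
  qed
  interpret vec_space "TYPE(real)" n .
  obtain U Q where U: "finite U" "card U = rank L"
    "\<And>i j. i < n \<Longrightarrow> j < n \<Longrightarrow> L $$ (i, j) = (\<Sum>u\<in>U. u $ i * Q u j)"
    using rank_factorization[OF L] by blast
  have "real (card J) \<le> real (card U) * (1 + 2 * C * T)"
  proof (rule weighted_design_factor_bound[where w = w and P = "\<lambda>u i. u $ i" and Q = Q
        and L = "\<lambda>i j. L $$ (i, j)"])
    show "finite I" "finite J" "finite U" by fact+
    show "L $$ (i, j) = (\<Sum>u\<in>U. u $ i * Q u j)" if "i \<in> I" "j \<in> J" for i j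
      using U(3) IJ that by blast
    show "w i j \<ge> 0" "w i j \<noteq> 0 \<Longrightarrow> L $$ (i, j) \<noteq> 0" for i j
      by (auto simp: w_def E_def split: if_splits)
    show "C > 0" using \<kappa> T by (simp add: C_def)
    show "real (card {i \<in> I. L $$ (i, j) \<noteq> 0 \<and> L $$ (i, k) \<noteq> 0}) \<le> T"
      if "j \<in> J" "k \<in> J" "j \<noteq> k" for j k
    proof -
      have "card {i \<in> I. L $$ (i, j) \<noteq> 0 \<and> L $$ (i, k) \<noteq> 0}
          \<le> card {i. i < n \<and> E i j \<and> E i k}"
        using IJ by (intro card_mono) (auto simp: E_def)
      then show ?thesis using meetE[of j k] that IJ by force
    qed
  qed (use cols rows T in auto)
  \<comment> \<open>The factor 2 pays for keeping only the columns in \<open>J\<close>, at least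
    half of them.\<close>
  then have "real n \<le> 2 * (real (rank L) * (1 + 2 * C * T))" using IJ(3) U(2) by simp
  also have "\<dots> = real (rank L) * (2 * (1 + 16 * T * (1 + T) / \<kappa>\<^sup>2))"
    by (simp add: C_def algebra_simps)
  finally show ?thesis .
qed

text \<open>Subtracting \<open>S\<close> costs each column at most half of
  \<open>c * sqrt n\<close>, so \<open>card_le_rank_of_design\<close> applies to \<open>L\<close>
  with \<open>\<kappa> = c / 2\<close>, whence the constant 64. The second bound on
  \<open>\<alpha>\<close> then forces \<open>n \<le> n / 2\<close>.\<close>

lemma monotonically_rigid_of_design:
  fixes A :: "real mat" and c T \<alpha> :: real
  assumes c: "c > 0" and T: "T > 0" and n: "n \<ge> 1" and A: "A \<in> carrier_mat n n"
    and design: "design_matrix q k t A" and k: "c * sqrt n \<le> k" and t: "t \<le> T"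
    and \<alpha>: "\<alpha> \<le> c / 2" "\<alpha> \<le> 1 / (4 * (1 + 64 * T * (1 + T) / c\<^sup>2))"
  shows "monotonically_rigid (\<alpha> * n) (\<alpha> * sqrt n) A"
  unfolding monotonically_rigid_def
proof (rule notI, elim exE conjE)
  fix L S
  assume L: "L \<in> carrier_mat (dim_row A) (dim_col A)" and S: "S \<in> carrier_mat (dim_row A) (dim_col A)"
    and LS: "A = L + S" and rk: "real (vec_space.rank (dim_row A) L) \<le> \<alpha> * n"
    and sparse: "\<forall>j<dim_col A. real (card (supp (col S j))) \<le> \<alpha> * sqrt n"
    and inside: "\<forall>i<dim_row A. \<forall>j<dim_col A. S $$ (i, j) \<noteq> 0 \<longrightarrow> A $$ (i, j) \<noteq> 0"
  have dims: "dim_row A = n" "dim_col A = n" using A by auto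
  have Ln: "L \<in> carrier_mat n n" and Sn: "S \<in> carrier_mat n n" using L S dims by auto
  have entry: "A $$ (i, j) = L $$ (i, j) + S $$ (i, j)" if "i < n" "j < n" for i j
    using LS Ln Sn that by simp
  define K where "K = 1 + 64 * T * (1 + T) / c\<^sup>2"
  have "K > 0" using T c unfolding K_def by (intro add_pos_nonneg) auto
  have fin: "finite (supp v)" for v :: "real vec" by (simp add: supp_def)
  have "real n \<le> real (vec_space.rank n L) * (2 * (1 + 16 * T * (1 + T) / (c / 2)\<^sup>2))"
  proof (rule card_le_rank_of_design[OF n _ _ Ln])
    show "c / 2 * sqrt n \<le> card (supp (col L j))" if "j < n" for j
    proof -
      have "supp (col A j) \<subseteq> supp (col L j) \<union> supp (col S j)"
        using that entry A Ln Sn by (auto simp: supp_def)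
      then have "card (supp (col A j)) \<le> card (supp (col L j)) + card (supp (col S j))"
        using card_mono[of "supp (col L j) \<union> supp (col S j)"] card_Un_le fin
        by (meson finite_UnI order_trans)
      moreover have "k \<le> card (supp (col A j))"
        using design that dims by (simp add: design_matrix_def)
      moreover have "real (card (supp (col S j))) \<le> \<alpha> * sqrt n"
        using sparse that dims by simp
      moreover have "\<alpha> * sqrt n \<le> c / 2 * sqrt n"
        using \<alpha>(1) by (rule mult_right_mono) simp
      ultimately show ?thesis using k by linarith
    qed
    show "real (card (supp (col L i) \<inter> supp (col L j))) \<le> T"
      if "i < n" "j < n" "i \<noteq> j" for i j
    proof -
      \<comment> \<open>Monotonicity enters here: where \<open>A\<close> is 0, so is
        \<open>S\<close>, and therefore \<open>L\<close>.\<close>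
      have "supp (col L j) \<subseteq> supp (col A j)" if "j < n" for j
        using that entry inside dims A Ln Sn by (auto simp: supp_def) (metis add.right_neutral)
      then have "card (supp (col L i) \<inter> supp (col L j)) \<le> card (supp (col A i) \<inter> supp (col A j))"
        using that fin by (intro card_mono) auto
      moreover have "card (supp (col A i) \<inter> supp (col A j)) \<le> t"
        using design that dims by (simp add: design_matrix_def)
      ultimately show ?thesis using t by simp
    qed
  qed (use c T in auto)
  also have "\<dots> = real (vec_space.rank n L) * (2 * K)"
    by (simp add: K_def power_divide)
  also have "\<dots> \<le> (\<alpha> * n) * (2 * K)"
    using rk dims \<open>K > 0\<close> by (intro mult_right_mono) auto
  also have "\<dots> \<le> (1 / (4 * K) * n) * (2 * K)"
    using \<alpha>(2) \<open>K > 0\<close> by (intro mult_right_mono) (auto simp: K_def)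
  also have "\<dots> = real n / 2" using \<open>K > 0\<close> by simp
  finally show False using n by simp
qed

section \<open>Projective planes\<close>

text \<open>The lines through a fixed point cover every other point exactly once, which counts the
  points; counting all incidences in two ways then counts the lines.\<close>

lemma projective_plane_of_order_card:
  assumes plane: "projective_plane_of_order p P Ls I"
  shows "card P = p\<^sup>2 + p + 1" "card Ls = p\<^sup>2 + p + 1"
proof -
  have "\<forall>x\<in>P. \<forall>y\<in>P. x \<noteq> y \<longrightarrow> (\<exists>!l. l \<in> Ls \<and> I x l \<and> I y l)"
    using plane unfolding projective_plane_of_order_def projective_plane_def by (elim conjE)
  then have join: "\<exists>!l. l \<in> Ls \<and> I x l \<and> I y l" if "x \<in> P" "y \<in> P" "x \<noteq> y" for x y
    using that by simp
  have "\<forall>l\<in>Ls. \<forall>m\<in>Ls. l \<noteq> m \<longrightarrow> (\<exists>!x. x \<in> P \<and> I x l \<and> I x m)"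
    using plane unfolding projective_plane_of_order_def projective_plane_def by (elim conjE)
  then have meet: "\<exists>!x. x \<in> P \<and> I x l \<and> I x m" if "l \<in> Ls" "m \<in> Ls" "l \<noteq> m" for l m
    using that by simp
  have "\<exists>Q\<subseteq>P. card Q = 4 \<and> (\<forall>l\<in>Ls. card {x \<in> Q. I x l} \<le> 2)"
    using plane unfolding projective_plane_of_order_def projective_plane_def by (elim conjE)
  then obtain Q where Q: "Q \<subseteq> P" "card Q = 4" "\<And>l. l \<in> Ls \<Longrightarrow> card {x \<in> Q. I x l} \<le> 2"
    by blast
  have fin: "finite P" "finite Ls" and size: "\<And>l. l \<in> Ls \<Longrightarrow> card {x \<in> P. I x l} = p + 1"
    using plane unfolding projective_plane_of_order_def by auto
  have finQ: "finite Q" using Q(1) fin(1) finite_subset by blast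
  \<comment> \<open>If all lines passed through \<open>x\<close>, the lines \<open>a b\<close> and
    \<open>a d\<close> would both be the line \<open>a x\<close>, putting three points of the
    quadrangle on one line.\<close>
  have miss: "\<exists>l\<in>Ls. \<not> I x l" if x: "x \<in> P" for x
  proof (rule ccontr)
    assume "\<not> ?thesis"
    then have all: "\<And>l. l \<in> Ls \<Longrightarrow> I x l" by blast
    have "card (Q - {x}) \<ge> 3" using Q(2) by (simp add: card_Diff_singleton_if)
    then obtain R where "R \<subseteq> Q - {x}" "card R = 3" by (metis obtain_subset_with_card_n)
    then obtain a b d where abd: "a \<in> Q" "b \<in> Q" "d \<in> Q" "a \<noteq> x" "a \<noteq> b" "a \<noteq> d" "b \<noteq> d"
      by (auto simp: card_3_iff)
    obtain l where l: "l \<in> Ls" "I a l" "I b l" using join[of a b] abd Q(1) by blast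
    obtain m where m: "m \<in> Ls" "I a m" "I d m" using join[of a d] abd Q(1) by blast
    have "l = m" using join[of a x] l m all x abd Q(1) by blast
    then have "{a, b, d} \<subseteq> {y \<in> Q. I y l}" using l m abd by blast
    then have "card {a, b, d} \<le> card {y \<in> Q. I y l}" using finQ by (intro card_mono) auto
    then show False using Q(3)[OF l(1)] abd by simp
  qed
  \<comment> \<open>Projection from \<open>x\<close> onto a line \<open>m\<close> missing
    \<open>x\<close>: points of \<open>m\<close> correspond to lines through
    \<open>x\<close>.\<close>
  have deg: "card {l \<in> Ls. I x l} = p + 1" if x: "x \<in> P" for x
  proof -
    obtain m where m: "m \<in> Ls" "\<not> I x m" using miss[OF x] by blast
    define f where "f y = (THE l. l \<in> Ls \<and> I x l \<and> I y l)" for y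
    define g where "g l = (THE y. y \<in> P \<and> I y l \<and> I y m)" for l
    have f: "f y \<in> Ls \<and> I x (f y) \<and> I y (f y)" if "y \<in> P" "I y m" for y
      unfolding f_def by (rule theI') (use join[of x y] x m that in blast)
    have g: "g l \<in> P \<and> I (g l) l \<and> I (g l) m" if "l \<in> Ls" "I x l" for l
      unfolding g_def by (rule theI') (use meet[of l m] m that in blast)
    have "bij_betw f {y \<in> P. I y m} {l \<in> Ls. I x l}"
    proof (rule bij_betw_byWitness[where f' = g])
      show "\<forall>y\<in>{y \<in> P. I y m}. g (f y) = y"
        using f g meet m by blast
      show "\<forall>l\<in>{l \<in> Ls. I x l}. f (g l) = l"
        using f g join[OF x] m by blast
    qed (use f g in auto)
    then show ?thesis using bij_betw_same_card size[OF m(1)] by fastforce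
  qed
  obtain x where x: "x \<in> P" using Q by fastforce
  \<comment> \<open>Count the incidences between the points and the lines through \<open>x\<close>.\<close>
  have "card {l \<in> {l \<in> Ls. I x l}. I y l} = (if y = x then p + 1 else 1)" if y: "y \<in> P" for y
  proof (cases "y = x")
    case True
    then show ?thesis using deg[OF x] by (simp add: conj_ac)
  next
    case False
    then obtain l where "{l \<in> {l \<in> Ls. I x l}. I y l} = {l}" using join[OF x y] by auto
    then show ?thesis using False by simp
  qed
  then have "(\<Sum>l\<in>{l \<in> Ls. I x l}. card {y \<in> P. I y l}) = (\<Sum>y\<in>P. if y = x then p + 1 else 1)"
    using fin by (intro sum_multicount_gen) auto
  also have "\<dots> = p + 1 + (card P - 1)"
    using x fin(1) by (simp add: sum.remove[of P x])
  finally have "(p + 1) * (p + 1) = p + 1 + (card P - 1)"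
    using deg[OF x] size by simp
  \<comment> \<open>Rules out truncation in \<open>card P - 1\<close>.\<close>
  moreover have "card P \<noteq> 0" using x fin(1) by auto
  ultimately show P: "card P = p\<^sup>2 + p + 1" by (simp add: power2_eq_square)
  have "(\<Sum>x\<in>P. card {l \<in> Ls. I x l}) = (\<Sum>l\<in>Ls. p + 1)"
    using fin size by (intro sum_multicount_gen) auto
  then have "card P * (p + 1) = card Ls * (p + 1)" using deg by simp
  then have "card P = card Ls" unfolding mult_cancel2 by simp
  then show "card Ls = p\<^sup>2 + p + 1" using P by simp
qed

text \<open>The row bound \<open>n\<close> is the trivial one; \<open>t = 1\<close> because two
  lines share one point. Distinctness of the enumerations transfers counts of points to counts of
  indices.\<close>

lemma plane_incidence_matrix_design:
  fixes A :: "real mat"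
  assumes plane: "plane_incidence_matrix p A" and n: "n = p\<^sup>2 + p + 1"
  shows "A \<in> carrier_mat n n" "\<forall>i<n. \<forall>j<n. A $$ (i, j) \<ge> 0" "design_matrix n (p + 1) 1 A"
proof -
  obtain ps ls :: "nat list" and I where dist: "distinct ps" "distinct ls"
    and order: "projective_plane_of_order p (set ps) (set ls) I"
    and A: "A = incidence_matrix ps ls I"
    using plane unfolding plane_incidence_matrix_def by blast
  have len: "length ps = n" "length ls = n"
    using projective_plane_of_order_card[OF order] dist n by (simp_all add: distinct_card)
  show carr: "A \<in> carrier_mat n n" unfolding A incidence_matrix_def len by simp
  have entry: "A $$ (i, j) = (if I (ps ! i) (ls ! j) then 1 else 0)" if "i < n" "j < n" for i j
    using that unfolding A incidence_matrix_def len by simp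
  then show "\<forall>i<n. \<forall>j<n. A $$ (i, j) \<ge> 0" by simp
  have supp: "supp (col A j) = {i. i < n \<and> I (ps ! i) (ls ! j)}" if "j < n" for j
    using that carr entry unfolding supp_def by (auto split: if_splits)
  have "card (supp (row A i)) \<le> n" if "i < n" for i
  proof -
    have "card (supp (row A i)) \<le> card {..<n}"
      using carr by (intro card_mono) (auto simp: supp_def)
    then show ?thesis by simp
  qed
  moreover have "card (supp (col A j)) = p + 1" if "j < n" for j
  proof -
    have "inj_on ((!) ps) (supp (col A j))"
      using dist len supp[OF that] by (auto simp: inj_on_def nth_eq_iff_index_eq)
    then have "card (supp (col A j)) = card ((!) ps ` supp (col A j))"
      by (simp add: card_image)
    also have "(!) ps ` supp (col A j) = {x \<in> set ps. I x (ls ! j)}"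
      unfolding supp[OF that] using len by (auto simp: in_set_conv_nth)
    also have "card \<dots> = p + 1"
      using order that len unfolding projective_plane_of_order_def by simp
    finally show ?thesis .
  qed
  moreover have "card (supp (col A j) \<inter> supp (col A k)) \<le> 1" if "j < n" "k < n" "j \<noteq> k" for j k
  proof -
    have "ls ! j \<in> set ls" "ls ! k \<in> set ls" "ls ! j \<noteq> ls ! k"
      using that len dist by (auto simp: nth_eq_iff_index_eq)
    then have "\<exists>!x. x \<in> set ps \<and> I x (ls ! j) \<and> I x (ls ! k)"
      using order unfolding projective_plane_of_order_def projective_plane_def by blast
    then have "ps ! i = ps ! i'" if "i \<in> supp (col A j) \<inter> supp (col A k)"
      "i' \<in> supp (col A j) \<inter> supp (col A k)" for i i'
      using that supp \<open>j < n\<close> \<open>k < n\<close> len by (metis (mono_tags, lifting) IntE mem_Collect_eq nth_mem)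
    then have "\<forall>i\<in>supp (col A j) \<inter> supp (col A k). \<forall>i'\<in>supp (col A j) \<inter> supp (col A k). i = i'"
      using supp that len dist by (auto simp: nth_eq_iff_index_eq)
    then show ?thesis by (simp add: card_le_Suc0_iff_eq supp_def)
  qed
  ultimately show "design_matrix n (p + 1) 1 A"
    using carr unfolding design_matrix_def by auto
qed

text \<open>The case \<open>n = 0\<close> is excluded because the empty decomposition meets every
  bound there. For planes, the constants are chosen before the order \<open>p\<close>, so they serve
  all planes at once.\<close>

theorem corollary4p4:
  shows
    "(\<forall>c T :: real. c > 0 \<longrightarrow> T > 0 \<longrightarrow>
        (\<exists>\<alpha>>0. \<forall>(n::nat) (A :: real mat) (q::nat) (k::nat) (t::nat).
           n \<ge> 1 \<longrightarrow>
           A \<in> carrier_mat n n \<longrightarrow>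
           (\<forall>i<n. \<forall>j<n. A $$ (i, j) \<ge> 0) \<longrightarrow>
           design_matrix q k t A \<longrightarrow>
           real k \<ge> c * sqrt (real n) \<longrightarrow>
           real t \<le> T \<longrightarrow>
           monotonically_rigid (\<alpha> * real n) (\<alpha> * sqrt (real n)) A))
     \<and>
     (\<exists>c>0. \<exists>T>0. \<exists>\<alpha>>0. \<forall>(p::nat) (n::nat) (A :: real mat).
        plane_incidence_matrix p A \<longrightarrow>
        n = p ^ 2 + p + 1 \<longrightarrow>
        A \<in> carrier_mat n n \<and>
        (\<forall>i<n. \<forall>j<n. A $$ (i, j) \<ge> 0) \<and>
        (\<exists>q k t. design_matrix q k t A \<and> real k \<ge> c * sqrt (real n) \<and> real t \<le> T) \<and>
        monotonically_rigid (\<alpha> * real n) (\<alpha> * sqrt (real n)) A)"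
proof (rule conjI)
  show rigid: "\<forall>c T :: real. c > 0 \<longrightarrow> T > 0 \<longrightarrow>
        (\<exists>\<alpha>>0. \<forall>(n::nat) (A :: real mat) (q::nat) (k::nat) (t::nat).
           n \<ge> 1 \<longrightarrow>
           A \<in> carrier_mat n n \<longrightarrow>
           (\<forall>i<n. \<forall>j<n. A $$ (i, j) \<ge> 0) \<longrightarrow>
           design_matrix q k t A \<longrightarrow>
           real k \<ge> c * sqrt (real n) \<longrightarrow>
           real t \<le> T \<longrightarrow>
           monotonically_rigid (\<alpha> * real n) (\<alpha> * sqrt (real n)) A)"
  proof (intro allI impI)
    fix c T :: real
    assume c: "c > 0" and T: "T > 0"
    \<comment> \<open>The first bound keeps the columns of \<open>L\<close> large, the second
      contradicts the rank estimate.\<close>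
    define \<alpha> where "\<alpha> = min (c / 2) (1 / (4 * (1 + 64 * T * (1 + T) / c\<^sup>2)))"
    have "\<alpha> > 0"
      using c T by (simp add: \<alpha>_def add_pos_nonneg)
    moreover have "\<alpha> \<le> c / 2" "\<alpha> \<le> 1 / (4 * (1 + 64 * T * (1 + T) / c\<^sup>2))"
      by (simp_all add: \<alpha>_def)
    ultimately show "\<exists>\<alpha>>0. \<forall>(n::nat) (A :: real mat) (q::nat) (k::nat) (t::nat).
           n \<ge> 1 \<longrightarrow>
           A \<in> carrier_mat n n \<longrightarrow>
           (\<forall>i<n. \<forall>j<n. A $$ (i, j) \<ge> 0) \<longrightarrow>
           design_matrix q k t A \<longrightarrow>
           real k \<ge> c * sqrt (real n) \<longrightarrow>
           real t \<le> T \<longrightarrow>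
           monotonically_rigid (\<alpha> * real n) (\<alpha> * sqrt (real n)) A"
      using monotonically_rigid_of_design[OF c T] by blast
  qed
  from rigid[rule_format, of 1 1] obtain \<alpha> :: real where \<alpha>: "\<alpha> > 0"
    "\<And>n (A :: real mat) q k t. n \<ge> 1 \<Longrightarrow> A \<in> carrier_mat n n \<Longrightarrow>
       \<forall>i<n. \<forall>j<n. A $$ (i, j) \<ge> 0 \<Longrightarrow> design_matrix q k t A \<Longrightarrow>
       real k \<ge> 1 * sqrt (real n) \<Longrightarrow> real t \<le> 1 \<Longrightarrow>
       monotonically_rigid (\<alpha> * real n) (\<alpha> * sqrt (real n)) A"
    by auto
  have goal: "A \<in> carrier_mat n n \<and>
        (\<forall>i<n. \<forall>j<n. A $$ (i, j) \<ge> 0) \<and>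
        (\<exists>q k t. design_matrix q k t A \<and> real k \<ge> 1 * sqrt (real n) \<and> real t \<le> 1) \<and>
        monotonically_rigid (\<alpha> * real n) (\<alpha> * sqrt (real n)) A"
    if plane: "plane_incidence_matrix p A" and n: "n = p ^ 2 + p + 1"
    for p n :: nat and A :: "real mat"
  proof -
    note design = plane_incidence_matrix_design[OF plane n]
    \<comment> \<open>\<open>(p + 1)\<^sup>2\<close> exceeds \<open>n\<close> by exactly
      \<open>p\<close>, so \<open>c = 1\<close> works for planes.\<close>
    have "real n \<le> (real (p + 1))\<^sup>2" using n by (simp add: power2_eq_square algebra_simps)
    then have k: "1 * sqrt (real n) \<le> real (p + 1)" by (simp add: real_le_lsqrt)
    have "n \<ge> 1" using n by simp
    then have "monotonically_rigid (\<alpha> * real n) (\<alpha> * sqrt (real n)) A"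
      using \<alpha>(2)[OF _ design k] by simp
    moreover have "\<exists>q k t. design_matrix q k t A \<and> real k \<ge> 1 * sqrt (real n) \<and> real t \<le> 1"
      using design(3) k by (intro exI[of _ n] exI[of _ "p + 1"] exI[of _ 1]) simp
    ultimately show ?thesis using design by blast
  qed
  show "\<exists>c>0. \<exists>T>0. \<exists>\<alpha>>0. \<forall>(p::nat) (n::nat) (A :: real mat).
        plane_incidence_matrix p A \<longrightarrow>
        n = p ^ 2 + p + 1 \<longrightarrow>
        A \<in> carrier_mat n n \<and>
        (\<forall>i<n. \<forall>j<n. A $$ (i, j) \<ge> 0) \<and>
        (\<exists>q k t. design_matrix q k t A \<and> real k \<ge> c * sqrt (real n) \<and> real t \<le> T) \<and>
        monotonically_rigid (\<alpha> * real n) (\<alpha> * sqrt (real n)) A"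
    by (rule exI[of _ "1 :: real"], rule conjI, simp, rule exI[of _ "1 :: real"], rule conjI, simp,
        rule exI[of _ \<alpha>], rule conjI[OF \<alpha>(1)], intro allI impI, rule goal)
qed

end
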